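(* For all integers $k > s \geq 3$, $$\lim_{n \to \infty} \frac{\log f_{s,k}(n)}{\log n} = 2.$$
   Context: A $k$-term arithmetic progression is a set of the form $\{x, x+d, \dots, x+(k-1)d\}$ of integers with common difference $d \neq 0$. A set of integers is $k$-AP free if it contains no such progression. For a finite set $A$ of integers, $f_s(A)$ denotes the number of $s$-term arithmetic progressions contained in $A$. For integers $k > s \geq 3$ and $n \geq 1$, $f_{s,k}(n)$ is the maximum of $f_s(A)$ over all sets $A$ of $n$ nonnegative integers that are $k$-AP free. Logarithms are base $2$. *)

theory Defs
  imports Complex_Main
begin

definition is_ap :: "nat \<Rightarrow> int set \<Rightarrow> bool" where
  "is_ap k P \<longleftrightarrow> (\<exists>x d. d \<noteq> 0 \<and> P = {x + int i * d | i. i < k})"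

definition ap_free :: "nat \<Rightarrow> int set \<Rightarrow> bool" where
  "ap_free k A \<longleftrightarrow> (\<nexists>P. is_ap k P \<and> P \<subseteq> A)"

text \<open>Progressions are counted as sets, so \<open>d\<close> and \<open>-d\<close> do not give two of them.\<close>

definition ap_count :: "nat \<Rightarrow> int set \<Rightarrow> nat" where
  "ap_count s A = card {P. is_ap s P \<and> P \<subseteq> A}"

text \<open>The maximum is over a finite set, as \<open>ap_count s A \<le> 2 ^ n\<close> whenever \<open>card A = n\<close> and
  \<open>A\<close> is finite; the set is nonempty for \<open>k \<ge> 3\<close>, witnessed by the first \<open>n\<close> powers of \<open>2\<close>.\<close>

definition max_ap_count :: "nat \<Rightarrow> nat \<Rightarrow> nat \<Rightarrow> nat" where
  "max_ap_count s k n =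
     Max {ap_count s A | A. finite A \<and> card A = n \<and> (\<forall>a\<in>A. 0 \<le> a) \<and> ap_free k A}"

end

theory Submission
  imports Defs "HOL-Real_Asymp.Real_Asymp"
begin

text \<open>The upper bound holds as two terms determine a progression. For the lower bound, a progression
  \<open>x + i d\<close> in \<open>\<int>\<^sup>D\<close> satisfies \<open>|x + i d|\<^sup>2 = a + 2 i b + i\<^sup>2 c\<close> with \<open>a = |x|\<^sup>2\<close>, \<open>b = x \<cdot> d\<close>, \<open>c = |d|\<^sup>2\<close>.
  When \<open>x\<close> and \<open>d\<close> range over \<open>[0, M)\<^sup>D\<close>, there are at most \<open>(D M\<^sup>2 + 1)\<^sup>3\<close> triples \<open>(a, b, c)\<close>, so some
  triple is shared by \<open>M\<^bsup>2D\<^esup> / (D M\<^sup>2 + 1)\<^sup>3\<close> pairs. Put the sphere of squared radius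
  \<open>a + 2 i b + i\<^sup>2 c\<close> in \<open>[0, s M)\<^sup>D\<close> on level \<open>i\<close>, for \<open>i < s\<close>: this set of at most \<open>s (s M)\<^sup>D\<close> points
  contains a progression of length \<open>s\<close> for each of those pairs, but none of length \<open>s + 1\<close>, which would
  have to stay on one level and put three collinear points on a sphere. Writing vectors in base \<open>2 s M\<close>
  embeds the set into the integers, without carries in sums of two elements. Finally let \<open>D\<close> and then \<open>M\<close> tend to infinity.\<close>

section \<open>Sets of digit vectors\<close>

definition box :: "nat \<Rightarrow> int \<Rightarrow> int list set" where
  "box D L = {xs. set xs \<subseteq> {0..<L} \<and> length xs = D}"

definition sq_norm :: "int list \<Rightarrow> int" where
  "sq_norm xs = (\<Sum>x\<leftarrow>xs. x\<^sup>2)"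

text \<open>The head of the list is the least significant digit in base \<open>B\<close>.\<close>

abbreviation enc :: "int \<Rightarrow> int list \<Rightarrow> int" where
  "enc \<equiv> horner_sum (\<lambda>a. a)"

lemma finite_box: "finite (box D L)"
  unfolding box_def by (rule finite_lists_length_eq) simp

lemma card_box: "card (box D L) = nat L ^ D"
  unfolding box_def by (subst card_lists_length_eq) auto

lemma enc_nonneg:
  assumes "set xs \<subseteq> {0..}" "0 \<le> B"
  shows "0 \<le> enc B xs"
  using assms by (induction xs) auto

text \<open>Both \<open>u + w\<close> and \<open>2 * v\<close> lie in [0, B), so reduction mod
  \<open>B\<close> isolates the lowest digit. That digit is a coordinate in
  \<open>sq_norm_midpoint\<close> and the level in \<open>stacked_spheres_ap_free\<close>.\<close>

lemma low_digit_midpoint: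
  fixes B :: int
  assumes eq: "(u + B * U) + (w + B * W) = 2 * (v + B * V)"
    and "u \<in> {0..<L}" "v \<in> {0..<L}" "w \<in> {0..<L}" "2 * L \<le> B"
  shows "u + w = 2 * v" "U + W = 2 * V"
proof -
  have bounds: "0 \<le> u + w" "u + w < B" "0 \<le> 2 * v" "2 * v < B"
    using assms by auto
  have sum: "(u + w) + B * (U + W) = 2 * v + B * (2 * V)"
    using eq by (simp add: algebra_simps)
  then have "((u + w) + B * (U + W)) mod B = (2 * v + B * (2 * V)) mod B"
    by simp
  then show "u + w = 2 * v"
    using bounds by simp
  then show "U + W = 2 * V"
    using sum bounds by simp
qed

text \<open>By the parallelogram law a sphere contains no nondegenerate midpoint configuration; since no
  carries occur, the same holds for the integers it encodes.\<close>

lemma sq_norm_midpoint: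
  assumes "length us = length vs" "length vs = length ws"
    and "set us \<subseteq> {0..<L}" "set vs \<subseteq> {0..<L}" "set ws \<subseteq> {0..<L}" and B: "2 * L \<le> B"
    and "enc B us + enc B ws = 2 * enc B vs"
  shows "2 * sq_norm vs \<le> sq_norm us + sq_norm ws \<and>
    (2 * sq_norm vs = sq_norm us + sq_norm ws \<longrightarrow> us = vs)"
  using assms(1-5,7)
proof (induction us vs ws rule: list_induct3)
  case Nil
  then show ?case by simp
next
  case (Cons u us v vs w ws)
  have "u + B * enc B us + (w + B * enc B ws) = 2 * (v + B * enc B vs)"
    using Cons.prems by simp
  from low_digit_midpoint[OF this _ _ _ B]
  have digit: "u + w = 2 * v" and rest: "enc B us + enc B ws = 2 * enc B vs"
    using Cons.prems by auto
  have w: "w = 2 * v - u" using digit by simp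
  \<comment> \<open>Each digit contributes the nonnegative excess \<open>2 * (u - v)^2\<close>; the
    excesses add up, so their sum vanishes only if every one of them does.\<close>
  have "u\<^sup>2 + w\<^sup>2 = 2 * v\<^sup>2 + 2 * (u - v)\<^sup>2"
    unfolding w by (simp add: power2_eq_square algebra_simps)
  moreover have "2 * sq_norm vs \<le> sq_norm us + sq_norm ws \<and>
      (2 * sq_norm vs = sq_norm us + sq_norm ws \<longrightarrow> us = vs)"
    using Cons.IH Cons.prems rest by simp
  moreover have "sq_norm (x # xs) = x\<^sup>2 + sq_norm xs" for x xs
    by (simp add: sq_norm_def)
  moreover have "0 \<le> (u - v)\<^sup>2" by simp
  ultimately have "2 * sq_norm (v # vs) \<le> sq_norm (u # us) + sq_norm (w # ws)"
    and "2 * sq_norm (v # vs) = sq_norm (u # us) + sq_norm (w # ws) \<longrightarrow> us = vs \<and> (u - v)\<^sup>2 = 0"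
    by smt+
  then show ?case by simp
qed

text \<open>Equal codes make both us, vs, us and vs, us, vs midpoint configurations. The two
  inequalities force equal norms, and then the equality case applies.\<close>

lemma inj_on_enc:
  assumes "2 * L \<le> B"
  shows "inj_on (enc B) (box D L)"
proof (rule inj_onI)
  fix us vs assume "us \<in> box D L" "vs \<in> box D L" and eq: "enc B us = enc B vs"
  then have box: "length us = length vs" "set us \<subseteq> {0..<L}" "set vs \<subseteq> {0..<L}"
    by (auto simp: box_def)
  show "us = vs"
    using sq_norm_midpoint[OF box(1) box(1)[symmetric] box(2,3,2) assms]
      sq_norm_midpoint[OF box(1)[symmetric] box(1) box(3,2,3) assms] eq by simp
qed

section \<open>Progressions of integers\<close>

text \<open>With positive difference the first term is the least element and the second term the
  next one, so the set determines both parameters. Sets can thus be counted by their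
  parameters.\<close>

lemma ap_set_inj:
  fixes x y d e :: int
  assumes eq: "{x + int i * d | i. i < s} = {y + int i * e | i. i < s}"
    and "0 < d" "0 < e" "2 \<le> s"
  shows "x = y" "d = e"
proof -
  have *: "y \<le> x" if "{x + int i * d | i. i < s} = {y + int i * e | i. i < s}" "0 < e"
    for x y d e :: int
  proof -
    have "x + int 0 * d \<in> {y + int i * e | i. i < s}"
      using that \<open>2 \<le> s\<close> by fastforce
    then show ?thesis using that(2) by auto
  qed
  show "x = y"
    using *[OF eq] *[OF eq[symmetric]] assms by simp
  have **: "e \<le> d" if "{x + int i * d | i. i < s} = {x + int i * e | i. i < s}" "0 < e" "0 < d"
    for d e :: int
  proof -
    have "x + int 1 * d \<in> {x + int i * e | i. i < s}"
      using that \<open>2 \<le> s\<close> by fastforce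
    then obtain i where "d = int i * e" by auto
    moreover from this that have "i \<noteq> 0" by (metis less_irrefl mult_zero_left of_nat_0)
    then have "1 * e \<le> int i * e"
      using that by (intro mult_right_mono) auto
    ultimately show ?thesis by simp
  qed
  show "d = e"
    using **[of d e] **[of e d] eq assms unfolding \<open>x = y\<close> by simp
qed

section \<open>Counting progressions in a finite set\<close>

lemma finite_ap_sets: "finite A \<Longrightarrow> finite {P. is_ap s P \<and> P \<subseteq> A}"
  by (rule finite_subset[of _ "Pow A"]) auto

lemma ap_count_mono: "finite B \<Longrightarrow> A \<subseteq> B \<Longrightarrow> ap_count s A \<le> ap_count s B"
  unfolding ap_count_def by (rule card_mono[OF finite_ap_sets]) auto

text \<open>A progression is determined by its first two terms.\<close>

lemma ap_count_le_square:
  assumes "finite A" "2 \<le> s"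
  shows "ap_count s A \<le> (card A)\<^sup>2"
proof -
  have "{P. is_ap s P \<and> P \<subseteq> A} \<subseteq> (\<lambda>(x, y). {x + int i * (y - x) | i. i < s}) ` (A \<times> A)"
  proof
    fix P assume "P \<in> {P. is_ap s P \<and> P \<subseteq> A}"
    then obtain x d where P: "P = {x + int i * d | i. i < s}" and "P \<subseteq> A"
      unfolding is_ap_def by auto
    have "x + int 0 * d \<in> P" "x + int 1 * d \<in> P"
      unfolding P using \<open>2 \<le> s\<close> by fastforce+
    with \<open>P \<subseteq> A\<close> have "(x, x + d) \<in> A \<times> A" by auto
    then show "P \<in> (\<lambda>(x, y). {x + int i * (y - x) | i. i < s}) ` (A \<times> A)"
      by (rule rev_image_eqI) (simp add: P)
  qed
  then have "ap_count s A \<le> card (A \<times> A)"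
    unfolding ap_count_def using assms(1) by (meson finite_SigmaI surj_card_le)
  then show ?thesis
    by (simp add: card_cartesian_product power2_eq_square)
qed

section \<open>Progression-free sets and their extension to \<open>n\<close> elements\<close>

lemma ap_free_mono:
  assumes "ap_free m A" "m \<le> k" "0 < m"
  shows "ap_free k A"
  unfolding ap_free_def
proof (rule notI, elim exE conjE)
  fix P assume "is_ap k P" "P \<subseteq> A"
  then obtain x d where "d \<noteq> 0" "P = {x + int i * d | i. i < k}"
    unfolding is_ap_def by auto
  then have "is_ap m {x + int i * d | i. i < m}" "{x + int i * d | i. i < m} \<subseteq> A"
    using \<open>P \<subseteq> A\<close> assms unfolding is_ap_def by fastforce+
  with assms show False unfolding ap_free_def by blast
qed

text \<open>A point beyond twice the maximum \<open>m\<close> forms no 3-term progression with two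
  points of [0, m]: as middle term it would be at most \<open>m\<close>, as an end term at most
  \<open>2 * m\<close>.\<close>

lemma ap_free_insert:
  assumes "finite A" "\<forall>a\<in>A. 0 \<le> a" "ap_free k A" "3 \<le> k"
  shows "\<exists>y. y \<notin> A \<and> 0 \<le> y \<and> ap_free k (insert y A)"
proof -
  define m where "m = Max (insert 0 A)"
  define y where "y = 2 * m + 1"
  have m: "0 \<le> m" "\<forall>a\<in>A. a \<le> m"
    unfolding m_def using assms(1) by auto
  have "ap_free k (insert y A)"
    unfolding ap_free_def
  proof (rule notI, elim exE conjE)
    fix P assume "is_ap k P" and sub: "P \<subseteq> insert y A"
    then obtain x d where d: "d \<noteq> 0" and P: "P = {x + int i * d | i. i < k}"
      unfolding is_ap_def by auto
    have "y \<in> P"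
      using \<open>is_ap k P\<close> sub assms(3) unfolding ap_free_def by blast
    then obtain i where i: "i < k" "y = x + int i * d" unfolding P by auto
    have other: "x + int j * d \<in> {0..m}" if "j < k" "j \<noteq> i" for j
    proof -
      have "x + int j * d \<in> insert y A" using that sub unfolding P by blast
      moreover have "x + int j * d \<noteq> y" using that d i by auto
      ultimately show ?thesis using m assms(2) by auto
    qed
    have "\<exists>z e. e \<noteq> 0 \<and> {z, z + e, z + 2 * e} \<subseteq> insert y {0..m} \<and> y \<in> {z, z + e, z + 2 * e}"
    proof -
      \<comment> \<open>A window of three consecutive indices containing \<open>i\<close>: it starts
        at \<open>i\<close> if there is room, and otherwise consists of the last three
        indices.\<close>
      define j where "j = (if i + 2 < k then i else k - 3)"
      have j: "j + 2 < k" "i = j \<or> i = j + 1 \<or> i = j + 2"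
        unfolding j_def using i assms(4) by auto
      have mem: "x + int l * d \<in> insert y {0..m}" if "l < k" for l
        using other[of l] i that by blast
      have "{x + int j * d, x + int j * d + d, x + int j * d + 2 * d} \<subseteq> insert y {0..m}"
        using mem[of j] mem[of "j + 1"] mem[of "j + 2"] j(1) by (auto simp: algebra_simps)
      moreover have "y \<in> {x + int j * d, x + int j * d + d, x + int j * d + 2 * d}"
        using j(2) i(2) by (auto simp: algebra_simps)
      ultimately show ?thesis using d by blast
    qed
    then obtain z e where "e \<noteq> 0" "{z, z + e, z + 2 * e} \<subseteq> insert y {0..m}" "y \<in> {z, z + e, z + 2 * e}"
      by blast
    then show False using m(1) unfolding y_def by simp presburger
  qed
  moreover have "y \<notin> A" using m unfolding y_def by force
  moreover have "0 \<le> y" using m(1) unfolding y_def by simp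
  ultimately show ?thesis by blast
qed

text \<open>The maximum ranges over sets of exactly \<open>n\<close> elements, whereas the
  construction gives at most \<open>n\<close>. Padding point by point loses no progression.\<close>

lemma ap_free_extend:
  assumes "finite A" "\<forall>a\<in>A. 0 \<le> a" "ap_free k A" "3 \<le> k" "card A \<le> n"
  shows "\<exists>A'. A \<subseteq> A' \<and> finite A' \<and> card A' = n \<and> (\<forall>a\<in>A'. 0 \<le> a) \<and> ap_free k A'"
  using assms(5)
proof (induction n rule: dec_induct)
  case base
  then show ?case using assms by blast
next
  case (step n)
  then obtain A' where A': "A \<subseteq> A'" "finite A'" "card A' = n" "\<forall>a\<in>A'. 0 \<le> a" "ap_free k A'"
    by blast
  from ap_free_insert[OF A'(2,4,5) assms(4)]
  obtain y where "y \<notin> A'" "0 \<le> y" "ap_free k (insert y A')" by blast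
  with A' show ?case by (intro exI[of _ "insert y A'"]) auto
qed

lemma
  assumes "2 \<le> s"
  shows finite_ap_counts:
      "finite {ap_count s A | A. finite A \<and> card A = n \<and> (\<forall>a\<in>A. 0 \<le> a) \<and> ap_free k A}"
    and ap_counts_subset:
      "{ap_count s A | A. finite A \<and> card A = n \<and> (\<forall>a\<in>A. 0 \<le> a) \<and> ap_free k A} \<subseteq> {..n\<^sup>2}"
proof -
  show sub: "{ap_count s A | A. finite A \<and> card A = n \<and> (\<forall>a\<in>A. 0 \<le> a) \<and> ap_free k A} \<subseteq> {..n\<^sup>2}"
    using ap_count_le_square assms by auto
  show "finite {ap_count s A | A. finite A \<and> card A = n \<and> (\<forall>a\<in>A. 0 \<le> a) \<and> ap_free k A}"
    by (rule finite_subset[OF sub]) simp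
qed

lemma ap_count_le_max_ap_count:
  assumes "finite A" "\<forall>a\<in>A. 0 \<le> a" "ap_free k A" "card A \<le> n" "2 \<le> s" "3 \<le> k"
  shows "ap_count s A \<le> max_ap_count s k n"
proof -
  from ap_free_extend[OF assms(1-3,6,4)]
  obtain A' where A': "A \<subseteq> A'" "finite A'" "card A' = n" "\<forall>a\<in>A'. 0 \<le> a" "ap_free k A'"
    by blast
  have "ap_count s A \<le> ap_count s A'"
    by (rule ap_count_mono) (use A' in auto)
  also have "\<dots> \<le> max_ap_count s k n"
    unfolding max_ap_count_def by (rule Max_ge[OF finite_ap_counts]) (use A' assms in auto)
  finally show ?thesis .
qed

lemma max_ap_count_le_square:
  assumes "2 \<le> s" "3 \<le> k"
  shows "max_ap_count s k n \<le> n\<^sup>2"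
proof -
  \<comment> \<open>Extending the empty set to \<open>n\<close> elements provides a competitor, so
    \<open>Max_in\<close> applies.\<close>
  have "ap_free k {}"
    unfolding ap_free_def is_ap_def using assms(2) by (auto intro: exI[of _ 0])
  then obtain A where "finite A \<and> card A = n \<and> (\<forall>a\<in>A. 0 \<le> a) \<and> ap_free k A"
    using ap_free_extend[of "{}" k n] assms by auto
  then have "{ap_count s A | A. finite A \<and> card A = n \<and> (\<forall>a\<in>A. 0 \<le> a) \<and> ap_free k A} \<noteq> {}"
    by blast
  from Max_in[OF finite_ap_counts this] show ?thesis
    unfolding max_ap_count_def using ap_counts_subset assms by blast
qed

section \<open>Stacked spheres\<close>

text \<open>The level \<open>i\<close> is the lowest digit in base \<open>2 * L\<close>, and the
  coordinates of \<open>y\<close> are the digits above it. The factor 2 leaves room for sums of two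
  digits.\<close>

definition stacked_spheres :: "nat \<Rightarrow> nat \<Rightarrow> int \<Rightarrow> (int \<Rightarrow> int) \<Rightarrow> int set" where
  "stacked_spheres s D L r =
     {i + 2 * L * enc (2 * L) y | i y. i \<in> {0..<int s} \<and> y \<in> box D L \<and> sq_norm y = r i}"

lemma stacked_spheres_finite_card:
  shows "finite (stacked_spheres s D L r)" "card (stacked_spheres s D L r) \<le> s * nat L ^ D"
proof -
  let ?f = "\<lambda>(i, y). i + 2 * L * enc (2 * L) y"
  have sub: "stacked_spheres s D L r \<subseteq> ?f ` ({0..<int s} \<times> box D L)"
    unfolding stacked_spheres_def by auto
  have fin: "finite ({0..<int s} \<times> box D L)" using finite_box by simp
  show "finite (stacked_spheres s D L r)"
    using finite_subset[OF sub] fin by blast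
  have "card (stacked_spheres s D L r) \<le> card ({0..<int s} \<times> box D L)"
    by (rule surj_card_le[OF fin sub])
  then show "card (stacked_spheres s D L r) \<le> s * nat L ^ D"
    by (simp add: card_cartesian_product card_box)
qed

lemma stacked_spheres_nonneg: "0 \<le> L \<Longrightarrow> a \<in> stacked_spheres s D L r \<Longrightarrow> 0 \<le> a"
  unfolding stacked_spheres_def box_def
  by (auto intro!: add_nonneg_nonneg mult_nonneg_nonneg enc_nonneg)

text \<open>Along a progression the levels form a progression themselves, which is constant when it has
  more than \<open>s\<close> terms; the progression then lies in a single sphere.\<close>

lemma stacked_spheres_ap_free:
  assumes "2 \<le> s" "int s \<le> L"
  shows "ap_free (Suc s) (stacked_spheres s D L r)"
  unfolding ap_free_def
proof (rule notI, elim exE conjE)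
  fix P assume "is_ap (Suc s) P" and sub: "P \<subseteq> stacked_spheres s D L r"
  then obtain x d where d: "d \<noteq> 0" and P: "P = {x + int j * d | j. j < Suc s}"
    unfolding is_ap_def by auto
  have "\<forall>j\<in>{..s}. \<exists>i y. i \<in> {0..<int s} \<and> y \<in> box D L \<and> sq_norm y = r i \<and>
      x + int j * d = i + 2 * L * enc (2 * L) y"
  proof
    fix j assume "j \<in> {..s}"
    then have "x + int j * d \<in> P" unfolding P by auto
    then have "x + int j * d \<in> stacked_spheres s D L r" using sub by blast
    then show "\<exists>i y. i \<in> {0..<int s} \<and> y \<in> box D L \<and> sq_norm y = r i \<and>
      x + int j * d = i + 2 * L * enc (2 * L) y"
      unfolding stacked_spheres_def by blast
  qed
  then obtain i y where iy: "\<And>j. j \<le> s \<Longrightarrow> i j \<in> {0..<int s}" "\<And>j. j \<le> s \<Longrightarrow> y j \<in> box D L"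
      "\<And>j. j \<le> s \<Longrightarrow> sq_norm (y j) = r (i j)"
      "\<And>j. j \<le> s \<Longrightarrow> x + int j * d = i j + 2 * L * enc (2 * L) (y j)"
    unfolding Bex_def by (metis atMost_iff)
  have mid: "i j + i (j + 2) = 2 * i (j + 1)"
      "enc (2 * L) (y j) + enc (2 * L) (y (j + 2)) = 2 * enc (2 * L) (y (j + 1))"
    if "j + 2 \<le> s" for j
  proof -
    have "(i j + 2 * L * enc (2 * L) (y j)) + (i (j + 2) + 2 * L * enc (2 * L) (y (j + 2)))
        = 2 * (i (j + 1) + 2 * L * enc (2 * L) (y (j + 1)))"
      using iy(4)[of j] iy(4)[of "j + 1"] iy(4)[of "j + 2"] that by (simp add: algebra_simps)
    from low_digit_midpoint[OF this, of "int s"]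
    show "i j + i (j + 2) = 2 * i (j + 1)"
      "enc (2 * L) (y j) + enc (2 * L) (y (j + 2)) = 2 * enc (2 * L) (y (j + 1))"
      using iy(1)[of j] iy(1)[of "j + 1"] iy(1)[of "j + 2"] that assms by auto
  qed
  \<comment> \<open>The midpoint relation is a second-order recurrence, so the induction carries two
    consecutive indices.\<close>
  have level: "(j \<le> s \<longrightarrow> i j = i 0 + int j * (i 1 - i 0)) \<and>
      (Suc j \<le> s \<longrightarrow> i (Suc j) = i 0 + int (Suc j) * (i 1 - i 0))" for j
  proof (induction j)
    case (Suc j)
    then show ?case using mid(1)[of j] by (auto simp: algebra_simps)
  qed simp
  \<comment> \<open>The \<open>s + 1\<close> terms span \<open>s\<close> steps, but two levels
    differ by less than \<open>s\<close>; hence the level step is 0.\<close>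
  have "int s * (i 1 - i 0) = i s - i 0" using level[of s] by simp
  then have "\<bar>int s * (i 1 - i 0)\<bar> < int s * 1"
    using iy(1)[of s] iy(1)[of 0] by auto
  then have "int s * \<bar>i 1 - i 0\<bar> < int s * 1"
    by (simp only: abs_mult abs_of_nat)
  then have "\<bar>i 1 - i 0\<bar> < 1"
    by (rule mult_less_cancel_left_pos[THEN iffD1, rotated]) (use assms(1) in simp)
  then have "i 1 = i 0" by simp
  moreover have "i 2 = i 0"
    using level[of 2] calculation assms(1) by simp
  ultimately have "sq_norm (y 1) = sq_norm (y 0)" "sq_norm (y 2) = sq_norm (y 0)"
    using iy(3)[of 0] iy(3)[of 1] iy(3)[of 2] assms(1) by auto
  \<comment> \<open>The first three terms now have vectors of equal norm, which is the equality case
    of the parallelogram law.\<close>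
  moreover have "2 * sq_norm (y 1) = sq_norm (y 0) + sq_norm (y 2) \<longrightarrow> y 0 = y 1"
    using sq_norm_midpoint[of "y 0" "y 1" "y 2" L "2 * L"] mid(2)[of 0]
      iy(2)[of 0] iy(2)[of 1] iy(2)[of 2] assms(1) unfolding box_def by (auto simp: numeral_2_eq_2)
  ultimately have "y 0 = y 1" by simp
  with \<open>i 1 = i 0\<close> iy(4)[of 0] iy(4)[of 1] assms(1) d show False by simp
qed

section \<open>Lines in a box and their three invariants\<close>

definition line_box :: "nat \<Rightarrow> nat \<Rightarrow> (int \<times> int) list set" where
  "line_box D M = {zs. set zs \<subseteq> {0..<int M} \<times> {0..<int M} \<and> length zs = D}"

text \<open>The inner product of start and direction, that is, the mixed term in the squared norm
  along the line.\<close>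

definition cross :: "(int \<times> int) list \<Rightarrow> int" where
  "cross zs = (\<Sum>(x, d)\<leftarrow>zs. x * d)"

definition line_point :: "int \<Rightarrow> (int \<times> int) list \<Rightarrow> int list" where
  "line_point t zs = map (\<lambda>(x, d). x + t * d) zs"

lemma finite_line_box: "finite (line_box D M)"
  unfolding line_box_def by (rule finite_lists_length_eq) simp

text \<open>Storing start and direction as one list of coordinate pairs turns the lines into words
  of length \<open>D\<close> over an alphabet of size \<open>M^2\<close>.\<close>

lemma card_line_box: "card (line_box D M) = (M\<^sup>2) ^ D"
  unfolding line_box_def
  by (subst card_lists_length_eq) (auto simp: card_cartesian_product power2_eq_square)

lemma enc_line_point:
  "enc B (line_point t zs) = enc B (map fst zs) + t * enc B (map snd zs)"
  unfolding line_point_def by (induction zs) (auto simp: algebra_simps)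

lemma sq_norm_line_point:
  "sq_norm (line_point t zs) =
     sq_norm (map fst zs) + 2 * t * cross zs + t\<^sup>2 * sq_norm (map snd zs)"
  unfolding line_point_def sq_norm_def cross_def
  by (induction zs) (auto simp: algebra_simps power2_eq_square)

text \<open>This explains the side \<open>s * M\<close>: \<open>x < M\<close> and
  \<open>i * d \<le> (s - 1) * M\<close>.\<close>

lemma line_point_in_box:
  assumes "zs \<in> line_box D M" "i < s"
  shows "line_point (int i) zs \<in> box D (int (s * M))"
proof -
  have "x + int i * d \<in> {0..<int (s * M)}" if "(x, d) \<in> set zs" for x d
  proof -
    from that assms have b: "0 \<le> x" "x < int M" "0 \<le> d" "d < int M"
      unfolding line_box_def by auto
    have "int i * d \<le> int (s - 1) * int M"
      using b assms(2) by (intro mult_mono) auto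
    also have "\<dots> = int (s * M) - int M"
      using assms(2) by (simp add: of_nat_diff algebra_simps)
    finally show ?thesis using b by auto
  qed
  then show ?thesis
    using assms(1) unfolding line_point_def line_box_def box_def by auto
qed

lemma map_fst_snd_in_box:
  assumes "zs \<in> line_box D M" "M \<le> L"
  shows "map fst zs \<in> box D (int L)" "map snd zs \<in> box D (int L)"
proof -
  have "fst z \<in> {0..<int L} \<and> snd z \<in> {0..<int L}" if "z \<in> set zs" for z
    using that assms unfolding line_box_def by (cases z) auto
  then show "map fst zs \<in> box D (int L)" "map snd zs \<in> box D (int L)"
    using assms(1) unfolding line_box_def box_def by auto
qed

lemma sum_list_bounds:
  fixes f :: "'a \<Rightarrow> int"
  assumes "\<And>z. z \<in> set zs \<Longrightarrow> 0 \<le> f z \<and> f z \<le> m"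
  shows "sum_list (map f zs) \<in> {0..int (length zs) * m}"
  using assms
proof (induction zs)
  case (Cons z zs)
  then have "sum_list (map f zs) \<in> {0..int (length zs) * m}" "0 \<le> f z \<and> f z \<le> m"
    by auto
  then show ?case by (auto simp: algebra_simps)
qed simp

lemma line_invariants_bounds:
  assumes "zs \<in> line_box D M"
  shows "sq_norm (map fst zs) \<in> {0..int (D * M\<^sup>2)}" "cross zs \<in> {0..int (D * M\<^sup>2)}"
    "sq_norm (map snd zs) \<in> {0..int (D * M\<^sup>2)}"
proof -
  have *: "0 \<le> x * y \<and> x * y \<le> (int M)\<^sup>2" if "x \<in> {0..<int M}" "y \<in> {0..<int M}" for x y
    using that unfolding power2_eq_square by (auto intro!: mult_mono)
  have **: "0 \<le> fst z * fst z \<and> fst z * fst z \<le> (int M)\<^sup>2"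
     "0 \<le> fst z * snd z \<and> fst z * snd z \<le> (int M)\<^sup>2"
     "0 \<le> snd z * snd z \<and> snd z * snd z \<le> (int M)\<^sup>2" if "z \<in> set zs" for z
    using * assms that unfolding line_box_def by fastforce+
  have "length zs = D" using assms unfolding line_box_def by simp
  then show "sq_norm (map fst zs) \<in> {0..int (D * M\<^sup>2)}" "cross zs \<in> {0..int (D * M\<^sup>2)}"
    "sq_norm (map snd zs) \<in> {0..int (D * M\<^sup>2)}"
    using sum_list_bounds[of zs "\<lambda>z. fst z * fst z", OF **(1)]
      sum_list_bounds[of zs "\<lambda>z. fst z * snd z", OF **(2)]
      sum_list_bounds[of zs "\<lambda>z. snd z * snd z", OF **(3)]
    unfolding sq_norm_def cross_def
    by (simp_all add: o_def power2_eq_square case_prod_unfold)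
qed

text \<open>Each line yields a progression whose term \<open>i\<close> is its point at parameter
  \<open>i\<close>, put on level \<open>i\<close>. Distinct lines give distinct sets by
  \<open>ap_set_inj\<close> and \<open>inj_on_enc\<close>.\<close>

lemma card_lines_le_ap_count:
  assumes "2 \<le> s" "1 \<le> M"
    and S: "S \<subseteq> line_box D M"
    and inv: "\<And>zs. zs \<in> S \<Longrightarrow>
      sq_norm (map fst zs) = a \<and> cross zs = b \<and> sq_norm (map snd zs) = c"
  shows "card S \<le> ap_count s (stacked_spheres s D (int (s * M)) (\<lambda>i. a + 2 * i * b + i\<^sup>2 * c))"
proof -
  define L where "L = int (s * M)"
  let ?A = "stacked_spheres s D L (\<lambda>i. a + 2 * i * b + i\<^sup>2 * c)"
  let ?x = "\<lambda>zs. 2 * L * enc (2 * L) (map fst zs)"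
  \<comment> \<open>The summand 1 raises the level by one per term and keeps the difference positive
    even for direction zero.\<close>
  let ?d = "\<lambda>zs. 1 + 2 * L * enc (2 * L) (map snd zs)"
  let ?P = "\<lambda>zs. {?x zs + int i * ?d zs | i. i < s}"
  have L: "0 < L" "M \<le> s * M" unfolding L_def using assms by auto
  have inbox: "map fst zs \<in> box D L" "map snd zs \<in> box D L" if "zs \<in> S" for zs
    using map_fst_snd_in_box[OF _ L(2)] that S unfolding L_def by auto
  have dpos: "0 < ?d zs" if "zs \<in> S" for zs
  proof -
    have "0 \<le> enc (2 * L) (map snd zs)"
      using inbox[OF that] L(1) unfolding box_def by (intro enc_nonneg) auto
    then have "0 \<le> 2 * L * enc (2 * L) (map snd zs)" using L(1) by simp
    then show ?thesis by simp
  qed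
  have "inj_on ?P S"
  proof (rule inj_onI)
    fix us vs assume us: "us \<in> S" and vs: "vs \<in> S" and eq: "?P us = ?P vs"
    note ap = ap_set_inj[OF eq dpos[OF us] dpos[OF vs] assms(1)]
    have inj: "inj_on (enc (2 * L)) (box D L)" by (rule inj_on_enc) simp
    have "map fst us = map fst vs"
      using ap(1) L(1) inbox[OF us] inbox[OF vs] by (auto dest: inj_onD[OF inj])
    moreover have "map snd us = map snd vs"
      using ap(2) L(1) inbox[OF us] inbox[OF vs] by (auto dest: inj_onD[OF inj])
    ultimately show "us = vs"
      by (metis zip_map_fst_snd)
  qed
  moreover have "?P ` S \<subseteq> {P. is_ap s P \<and> P \<subseteq> ?A}"
  proof (rule image_subsetI, rule CollectI, rule conjI)
    fix zs assume zs: "zs \<in> S"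
    show "is_ap s (?P zs)"
      unfolding is_ap_def using dpos[OF zs] by (intro exI[of _ "?x zs"] exI[of _ "?d zs"]) auto
    show "?P zs \<subseteq> ?A"
    proof
      fix p assume "p \<in> ?P zs"
      then obtain i where i: "i < s" "p = ?x zs + int i * ?d zs" by auto
      have "p = int i + 2 * L * enc (2 * L) (line_point (int i) zs)"
        unfolding i(2) enc_line_point by (simp add: algebra_simps)
      moreover have "line_point (int i) zs \<in> box D L"
        using line_point_in_box i(1) zs S unfolding L_def by blast
      moreover have "sq_norm (line_point (int i) zs) = a + 2 * int i * b + (int i)\<^sup>2 * c"
        unfolding sq_norm_line_point using inv[OF zs] by simp
      ultimately show "p \<in> ?A"
        unfolding stacked_spheres_def using i(1) by fastforce
    qed
  qed
  ultimately show ?thesis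
    unfolding ap_count_def L_def[symmetric]
    by (rule card_inj_on_le) (rule finite_ap_sets[OF stacked_spheres_finite_card(1)])
qed

text \<open>Pigeonhole as a sum: no largest fiber is chosen; every fiber of the invariants is
  bounded by the maximum, and \<open>(D * M^2 + 1)^3\<close> fibers cover all lines.\<close>

lemma max_ap_count_ge:
  assumes "3 \<le> s" "s < k" "1 \<le> M" "s * (s * M) ^ D \<le> n"
  shows "(M\<^sup>2) ^ D \<le> max_ap_count s k n * (D * M\<^sup>2 + 1) ^ 3"
proof -
  define f where "f zs = (sq_norm (map fst zs), cross zs, sq_norm (map snd zs))" for zs
  define I where "I = {0..int (D * M\<^sup>2)}"
  let ?fiber = "\<lambda>c. {zs \<in> line_box D M. f zs = c}"
  have "card (?fiber p) \<le> max_ap_count s k n" for p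
  proof -
    obtain a b c where p: "p = (a, b, c)" by (cases p)
    let ?A = "stacked_spheres s D (int (s * M)) (\<lambda>i. a + 2 * i * b + i\<^sup>2 * c)"
    have "card (?fiber p) \<le> ap_count s ?A"
      using assms by (intro card_lines_le_ap_count) (auto simp: f_def p)
    also have "\<dots> \<le> max_ap_count s k n"
    proof (rule ap_count_le_max_ap_count)
      show "finite ?A" by (rule stacked_spheres_finite_card)
      show "\<forall>a\<in>?A. 0 \<le> a" by (rule ballI, rule stacked_spheres_nonneg[of "int (s * M)"]) simp_all
      show "ap_free k ?A"
        by (rule ap_free_mono[OF stacked_spheres_ap_free]) (use assms in auto)
      show "card ?A \<le> n"
        by (rule order_trans[OF stacked_spheres_finite_card(2)])
          (use assms(4) in \<open>simp del: of_nat_mult\<close>)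
    qed (use assms in auto)
    finally show ?thesis .
  qed
  then have fibers: "(\<Sum>p\<in>I \<times> I \<times> I. card (?fiber p)) \<le> card (I \<times> I \<times> I) * max_ap_count s k n"
    using sum_bounded_above[of "I \<times> I \<times> I" "\<lambda>p. card (?fiber p)" "max_ap_count s k n"] by simp
  have "line_box D M \<subseteq> (\<Union>p\<in>I \<times> I \<times> I. ?fiber p)"
    using line_invariants_bounds unfolding f_def I_def by auto
  then have "card (line_box D M) \<le> card (\<Union>p\<in>I \<times> I \<times> I. ?fiber p)"
    by (rule card_mono[rotated]) (auto simp: I_def finite_line_box)
  also have "\<dots> \<le> (\<Sum>p\<in>I \<times> I \<times> I. card (?fiber p))"
    by (rule card_UN_le) (simp add: I_def)
  also note fibers
  also have "card (I \<times> I \<times> I) = (D * M\<^sup>2 + 1) ^ 3"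
  proof -
    have "card I = D * M\<^sup>2 + 1" unfolding I_def by (simp del: of_nat_mult of_nat_power)
    then show ?thesis unfolding card_cartesian_product power3_eq_cube by (simp only: mult.assoc)
  qed
  finally show ?thesis by (simp add: card_line_box mult.commute)
qed

section \<open>Asymptotics\<close>

lemma log_max_ap_count_ge:
  assumes "3 \<le> s" "s < k" "2 \<le> M" "s \<le> n"
  defines "y \<equiv> log 2 (real n)"
  shows "2 * log 2 (real M) * ((y - log 2 (real s)) / log 2 (real (s * M)) - 1)
      - 3 * log 2 (y * (real M)\<^sup>2 + 1) \<le> log 2 (real (max_ap_count s k n))"
proof -
  define logL where "logL = log 2 (real (s * M))"
  \<comment> \<open>The real solution of \<open>s * (s * M)^q = n\<close>; its floor is the largest
    dimension whose point set is sure to fit into \<open>n\<close> elements.\<close>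
  define q where "q = (y - log 2 (real s)) / logL"
  define D where "D = nat \<lfloor>q\<rfloor>"
  have "2 * 1 \<le> s * M" using assms by (intro mult_mono) auto
  then have "2 \<le> real (s * M)" by linarith
  then have logL: "1 \<le> logL" unfolding logL_def by simp
  have s0: "0 \<le> log 2 (real s)" using assms by simp
  have ys: "log 2 (real s) \<le> y" unfolding y_def using assms by simp
  have q0: "0 \<le> q" unfolding q_def using ys logL by simp
  have D: "q - 1 \<le> real D" "real D \<le> q"
    unfolding D_def using q0 by linarith+
  \<comment> \<open>This gives \<open>D \<le> y\<close>, used in the error term; the main term uses
    \<open>q - 1 \<le> D\<close>.\<close>
  have "q * 1 \<le> q * logL" using q0 logL by (intro mult_left_mono) auto
  also have q_mult: "q * logL = y - log 2 (real s)" unfolding q_def using logL by simp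
  finally have "real D \<le> y" using D s0 by simp
  have "log 2 (real s * real (s * M) ^ D) = log 2 (real s) + real D * logL"
    unfolding logL_def using assms by (simp add: log_mult log_nat_power)
  also have "\<dots> \<le> log 2 (real s) + q * logL"
    using D logL by (intro add_left_mono mult_right_mono) auto
  also have "\<dots> = log 2 (real n)" unfolding q_mult y_def by simp
  finally have "real s * real (s * M) ^ D \<le> real n"
    using assms by (subst (asm) log_le_cancel_iff) auto
  then have "s * (s * M) ^ D \<le> n"
    by (metis of_nat_le_iff of_nat_mult of_nat_power)
  from max_ap_count_ge[OF assms(1,2) _ this] assms(3)
  have *: "(M\<^sup>2) ^ D \<le> max_ap_count s k n * (D * M\<^sup>2 + 1) ^ 3" by simp
  have "0 < (M\<^sup>2) ^ D" using assms(3) by simp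
  with * have pos: "0 < max_ap_count s k n" by (metis gr0I mult_0 not_le)
  have "2 * log 2 (real M) * (q - 1) \<le> 2 * log 2 (real M) * real D"
    using D assms(3) by (intro mult_left_mono) auto
  also have "\<dots> = log 2 (real ((M\<^sup>2) ^ D))"
    using assms(3) by (simp add: log_nat_power)
  also have "\<dots> \<le> log 2 (real (max_ap_count s k n * (D * M\<^sup>2 + 1) ^ 3))"
    using * assms(3) pos by (subst log_le_cancel_iff) (auto simp del: of_nat_mult of_nat_power)
  also have "\<dots> = log 2 (real (max_ap_count s k n)) + log 2 (real (D * M\<^sup>2 + 1) ^ 3)"
    unfolding of_nat_mult of_nat_power 
  proof (rule log_mult_pos)
    have "0 < D * M\<^sup>2 + 1" by simp
    then show "0 < real (D * M\<^sup>2 + 1) ^ 3" by (metis of_nat_0_less_iff zero_less_power)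
  qed (use pos in simp)
  also have "log 2 (real (D * M\<^sup>2 + 1) ^ 3) = 3 * log 2 (real (D * M\<^sup>2 + 1))"
    by (subst log_nat_power) auto
  also have "log 2 (real (D * M\<^sup>2 + 1)) \<le> log 2 (y * (real M)\<^sup>2 + 1)"
  proof -
    have "real D * (real M)\<^sup>2 \<le> y * (real M)\<^sup>2"
      using \<open>real D \<le> y\<close> by (intro mult_right_mono) auto
    moreover have "0 \<le> real D * (real M)\<^sup>2" by simp
    ultimately have "0 < real (D * M\<^sup>2 + 1)" "real (D * M\<^sup>2 + 1) \<le> y * (real M)\<^sup>2 + 1"
      unfolding of_nat_add of_nat_mult of_nat_power of_nat_1 by linarith+
    then show ?thesis by (subst log_le_cancel_iff) auto
  qed
  finally show ?thesis unfolding q_def logL_def by simp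
qed

theorem theorem1:
  fixes s k :: nat
  assumes "3 \<le> s" and "s < k"
  shows "(\<lambda>n. log 2 (real (max_ap_count s k n)) / log 2 (real n)) \<longlonglongrightarrow> 2"
proof (rule order_tendstoI)
  fix a :: real assume "a < 2"
  have spos: "real s > 0" using assms by simp
  \<comment> \<open>For fixed \<open>M\<close> the lower bound on the exponent tends to
    \<open>2 * log M / log (s * M)\<close> as \<open>n\<close> grows; \<open>M\<close> is fixed so
    that this exceeds \<open>a\<close>.\<close>
  then have "(\<lambda>M. 2 * log 2 (real M) / (log 2 (real s) + log 2 (real M))) \<longlonglongrightarrow> 2"
    by real_asymp
  then have "eventually (\<lambda>M. a < 2 * log 2 (real M) / (log 2 (real s) + log 2 (real M))) sequentially"
    using \<open>a < 2\<close> by (rule order_tendstoD)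
  then obtain M where M: "2 \<le> M" "a < 2 * log 2 (real M) / (log 2 (real s) + log 2 (real M))"
    using eventually_conj[OF _ eventually_ge_at_top[of 2]] eventually_happens' sequentially_bot
    by (metis (no_types, lifting))
  define logL where "logL = log 2 (real (s * M))"
  define \<sigma> where "\<sigma> = log 2 (real s)"
  define c where "c = log 2 (real M)"
  define R where "R = (real M)\<^sup>2"
  \<comment> \<open>The bound of \<open>log_max_ap_count_ge\<close> divided by \<open>y\<close>, as
    a function of a real \<open>y\<close> that stands for \<open>log n\<close>. The subtracted
    logarithm is negligible against \<open>y\<close>.\<close>
  define g where "g y = (2 * c * ((y - \<sigma>) / logL - 1) - 3 * log 2 (y * R + 1)) / y" for y :: real
  have logL_eq: "logL = \<sigma> + c"
    unfolding logL_def \<sigma>_def c_def using spos M(1) by (simp add: log_mult)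
  have pos: "0 < c" "0 \<le> \<sigma>" "0 < R"
    unfolding c_def \<sigma>_def R_def using assms M(1) by auto
  then have "0 < logL" unfolding logL_eq by simp
  then have "(g \<longlongrightarrow> 2 * c / logL) at_top"
    unfolding g_def using pos by (real_asymp simp: field_simps)
  moreover have "a < 2 * c / logL"
    using M(2) unfolding logL_eq \<sigma>_def c_def by simp
  ultimately have "eventually (\<lambda>y. a < g y) at_top"
    by (rule order_tendstoD)
  moreover have "filterlim (\<lambda>n. log 2 (real n)) at_top sequentially"
    by real_asymp
  ultimately have "eventually (\<lambda>n. a < g (log 2 (real n))) sequentially"
    by (rule eventually_compose_filterlim)
  then show "eventually (\<lambda>n. a < log 2 (real (max_ap_count s k n)) / log 2 (real n)) sequentially"
    using eventually_ge_at_top[of s]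
  proof eventually_elim
    case (elim n)
    have "0 < log 2 (real n)" using elim(2) assms by simp
    then have "g (log 2 (real n)) \<le> log 2 (real (max_ap_count s k n)) / log 2 (real n)"
      unfolding g_def c_def \<sigma>_def logL_def R_def
      using log_max_ap_count_ge[OF assms M(1) elim(2)] by (intro divide_right_mono) auto
    with elim(1) show ?case by simp
  qed
next
  fix a :: real assume "2 < a"
  have "log 2 (real (max_ap_count s k n)) / log 2 (real n) < a" if "2 \<le> n" for n
  proof -
    have n: "0 < log 2 (real n)" using that by simp
    have "log 2 (real (max_ap_count s k n)) \<le> 2 * log 2 (real n)"
    proof (cases "max_ap_count s k n = 0")
      case True
      \<comment> \<open>By convention \<open>ln 0 = 0\<close>, so the left side is 0.\<close>
      then show ?thesis using n by (simp add: log_def)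
    next
      case False
      have "real (max_ap_count s k n) \<le> real n ^ 2"
        using of_nat_mono[OF max_ap_count_le_square[of s k n], where 'a = real] assms by simp
      then have "log 2 (real (max_ap_count s k n)) \<le> log 2 (real n ^ 2)"
        using False that by (subst log_le_cancel_iff) auto
      then show ?thesis using that by (simp add: log_nat_power)
    qed
    then have "log 2 (real (max_ap_count s k n)) / log 2 (real n) \<le> 2"
      using n by (simp add: divide_le_eq)
    with \<open>2 < a\<close> show ?thesis by simp
  qed
  then show "eventually (\<lambda>n. log 2 (real (max_ap_count s k n)) / log 2 (real n) < a) sequentially"
    by (rule eventually_sequentiallyI)
qed

end
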